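(* A $\Gamma$-odometer $(\mathfrak{X},\Gamma,\Phi)$ which is $d$-regular has finite typeset $\Xi[\mathfrak{X},\Gamma,\Phi]$. More precisely, suppose $(\mathfrak{X},\Gamma,\Phi)$ is isomorphic to an action on a $d$-ary rooted tree, for some $d\geq2$. Let $P_d$ be the set of distinct prime divisors of the integers $\{2,\ldots,d\}$, and let $N_d=|P_d|$. Then the cardinality of the typeset satisfies $$|\Xi[\mathfrak{X},\Gamma,\Phi]|\ \leq\ \sum_{k=0}^{N_d}\binom{N_d}{k}=\sum_{k=0}^{N_d}\frac{N_d!}{(N_d-k)!\,k!}.$$ Moreover, each type $\tau\in\Xi[\mathfrak{X},\Gamma,\Phi]$ is represented by a Steinitz number $\xi$ with empty finite prime spectrum $\pi_f(\xi)$, and so $\pi(\xi)=\pi_\infty(\xi)$.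
   Context: Odometers. A Cantor action $(\mathfrak{X},\Gamma,\Phi)$ is an action of a group $\Gamma$ by homeomorphisms on a Cantor space $\mathfrak{X}$. An odometer is a Cantor action which is minimal (all orbits dense) and equicontinuous. Actions $(\mathfrak{X}_1,\Gamma_1,\Phi_1)$, $(\mathfrak{X}_2,\Gamma_2,\Phi_2)$ are isomorphic if there are a homeomorphism $h\colon\mathfrak{X}_1\to\mathfrak{X}_2$ and a group isomorphism $\Theta\colon\Gamma_1\to\Gamma_2$ with $\Phi_1(g)=h^{-1}\circ\Phi_2(\Theta(g))\circ h$ for all $g\in\Gamma_1$. Trees. A rooted tree $T$ has vertex set $V=\bigsqcup_{\ell\ge0}V_\ell$ with each $V_\ell$ finite, $|V_0|=1$, and edges joining only vertices in consecutive levels, each vertex of $V_{\ell+1}$ being joined to exactly one vertex of $V_\ell$. $T$ is $d$-ary if for every $\ell\ge1$ each vertex in $V_{\ell-1}$ is joined to precisely $d$ vertices in $V_\ell$. The boundary $\partial T$ is the space of infinite paths $(v_\ell)_{\ell\ge0}\in\prod_\ell V_\ell$, with $v_{\ell+1}$ and $v_\ell$ joined by an edge; an action of $\Gamma$ on $T$ by (root- and level-preserving) tree automorphisms induces an action on $\partial T$. An odometer is $d$-regular ($d\ge2$) if it is isomorphic to the action on $\partial T$ induced by an action of $\Gamma$ on a rooted $d$-ary tree $T$. Group chain models. A group chain $\mathcal{G}=\{\Gamma=\Gamma_0\supset\Gamma_1\supset\cdots\}$ is a descending chain of finite index subgroups (not assumed normal). Put $X_\ell=\Gamma/\Gamma_\ell$,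 $X_\infty=\varprojlim\{X_{\ell+1}\to X_\ell\}$, with $\Phi_\infty$ the action of $\Gamma$ on $X_\infty$ induced by left multiplication. $\mathcal{G}$ is a group chain model for $(\mathfrak{X},\Gamma,\Phi)$ if there is a homeomorphism $\mathfrak{X}\to X_\infty$ conjugating $\Phi$ to $\Phi_\infty$ (as $\Gamma$-actions). Every odometer is known to have a group chain model. Types and typesets. A Steinitz number is a formal product $\xi=\prod_{p}p^{\chi_\xi(p)}$ over all primes $p$, with $\chi_\xi(p)\in\{0,1,\ldots,\infty\}$; the least common multiple of a collection of positive integers is a Steinitz number, with exponent at $p$ the supremum of the exponents. Its prime spectra are $\pi(\xi)=\{p\mid\chi_\xi(p)>0\}$, $\pi_f(\xi)=\{p\mid0<\chi_\xi(p)<\infty\}$, $\pi_\infty(\xi)=\{p\mid\chi_\xi(p)=\infty\}$. $\xi,\xi'$ are asymptotically equivalent if $m\cdot\xi=m'\cdot\xi'$ for some integers $m,m'\ge1$; the equivalence class of $\xi$ is its type $\tau[\xi]$. For a group chain $\mathcal{G}$ let $C_\ell=\bigcap_{\delta\in\Gamma}\delta\Gamma_\ell\delta^{-1}$; for $\gamma\in\Gamma$ let $\xi(\gamma)=\mathrm{lcm}\{\#(\langle\gamma\rangle/(\langle\gamma\rangle\cap C_\ell))\mid\ell>0\}$ and $\tau[\gamma]=\tau[\xi(\gamma)]$. The typeset of the odometer is $\Xi[\mathfrak{X},\Gamma,\Phi]=\{\tau[\gamma]\mid\gamma\in\Gamma\}$, computed from a choice of group chain model (it does not depend on the choice). *)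

theory Defs
  imports
    "HOL-Analysis.Analysis"
    "HOL-Algebra.Group_Action"
    "HOL-Algebra.Left_Coset"
    "HOL-Algebra.Generated_Groups"
    "HOL-Computational_Algebra.Primes"
    "HOL-Library.Extended_Nat"
begin

section \<open>Cantor actions and odometers\<close>

definition cantor_space :: "'x topology \<Rightarrow> bool" where
  "cantor_space X \<longleftrightarrow>
     X homeomorphic_space
       product_topology (\<lambda>_ :: nat. discrete_topology (UNIV :: bool set)) UNIV"

definition cantor_action ::
    "('g, 'b) monoid_scheme \<Rightarrow> 'x topology \<Rightarrow> ('g \<Rightarrow> 'x \<Rightarrow> 'x) \<Rightarrow> bool" where
  "cantor_action \<Gamma> X \<Phi> \<longleftrightarrow>
     cantor_space X \<and> group_action \<Gamma> (topspace X) \<Phi> \<and>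
     (\<forall>g \<in> carrier \<Gamma>. homeomorphic_map X X (\<Phi> g))"

definition minimal_action ::
    "('g, 'b) monoid_scheme \<Rightarrow> 'x topology \<Rightarrow> ('g \<Rightarrow> 'x \<Rightarrow> 'x) \<Rightarrow> bool" where
  "minimal_action \<Gamma> X \<Phi> \<longleftrightarrow>
     (\<forall>x \<in> topspace X. X closure_of orbit \<Gamma> \<Phi> x = topspace X)"

text \<open>Equicontinuity with respect to a metric inducing the topology.  On a compact space any two
  such metrics are uniformly equivalent, so the choice of metric is immaterial.\<close>

definition equicontinuous_action ::
    "('g, 'b) monoid_scheme \<Rightarrow> 'x topology \<Rightarrow> ('g \<Rightarrow> 'x \<Rightarrow> 'x) \<Rightarrow> bool" where
  "equicontinuous_action \<Gamma> X \<Phi> \<longleftrightarrow>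
     (\<exists>D. Metric_space (topspace X) D \<and> Metric_space.mtopology (topspace X) D = X \<and>
       (\<forall>\<epsilon> > 0. \<exists>\<delta> > 0. \<forall>g \<in> carrier \<Gamma>. \<forall>x \<in> topspace X. \<forall>y \<in> topspace X.
          D x y < \<delta> \<longrightarrow> D (\<Phi> g x) (\<Phi> g y) < \<epsilon>))"

definition odometer ::
    "('g, 'b) monoid_scheme \<Rightarrow> 'x topology \<Rightarrow> ('g \<Rightarrow> 'x \<Rightarrow> 'x) \<Rightarrow> bool" where
  "odometer \<Gamma> X \<Phi> \<longleftrightarrow>
     cantor_action \<Gamma> X \<Phi> \<and> minimal_action \<Gamma> X \<Phi> \<and> equicontinuous_action \<Gamma> X \<Phi>"

definition isomorphic_actions ::
    "('g, 'b) monoid_scheme \<Rightarrow> 'x topology \<Rightarrow> ('g \<Rightarrow> 'x \<Rightarrow> 'x) \<Rightarrow>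
     ('h, 'c) monoid_scheme \<Rightarrow> 'y topology \<Rightarrow> ('h \<Rightarrow> 'y \<Rightarrow> 'y) \<Rightarrow> bool" where
  "isomorphic_actions \<Gamma>\<^sub>1 X\<^sub>1 \<Phi>\<^sub>1 \<Gamma>\<^sub>2 X\<^sub>2 \<Phi>\<^sub>2 \<longleftrightarrow>
     (\<exists>h \<Theta>. homeomorphic_map X\<^sub>1 X\<^sub>2 h \<and> \<Theta> \<in> iso \<Gamma>\<^sub>1 \<Gamma>\<^sub>2 \<and>
       (\<forall>g \<in> carrier \<Gamma>\<^sub>1. \<forall>x \<in> topspace X\<^sub>1. h (\<Phi>\<^sub>1 g x) = \<Phi>\<^sub>2 (\<Theta> g) (h x)))"


section \<open>Rooted trees and regular odometers\<close>

text \<open>A tree is given by its levels \<open>V\<close> and its set \<open>E\<close> of undirected edges, an edge being the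
  set of its two endpoints.\<close>

definition rooted_tree :: "(nat \<Rightarrow> 'v set) \<Rightarrow> 'v set set \<Rightarrow> bool" where
  "rooted_tree V E \<longleftrightarrow>
     disjoint_family V \<and> (\<forall>l. finite (V l)) \<and> card (V 0) = 1 \<and>
     (\<forall>e \<in> E. \<exists>l. \<exists>u \<in> V l. \<exists>v \<in> V (Suc l). e = {u, v}) \<and>
     (\<forall>l. \<forall>v \<in> V (Suc l). \<exists>!u. u \<in> V l \<and> {u, v} \<in> E)"

definition d_ary_tree :: "nat \<Rightarrow> (nat \<Rightarrow> 'v set) \<Rightarrow> 'v set set \<Rightarrow> bool" where
  "d_ary_tree d V E \<longleftrightarrow>
     rooted_tree V E \<and> (\<forall>l \<ge> 1. \<forall>u \<in> V (l - 1). card {v \<in> V l. {u, v} \<in> E} = d)"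

definition boundary :: "(nat \<Rightarrow> 'v set) \<Rightarrow> 'v set set \<Rightarrow> (nat \<Rightarrow> 'v) set" where
  "boundary V E = {w. \<forall>l. w l \<in> V l \<and> {w l, w (Suc l)} \<in> E}"

definition boundary_topology :: "(nat \<Rightarrow> 'v set) \<Rightarrow> 'v set set \<Rightarrow> (nat \<Rightarrow> 'v) topology" where
  "boundary_topology V E =
     subtopology (product_topology (\<lambda>l. discrete_topology (V l)) UNIV) (boundary V E)"

definition tree_action ::
    "('g, 'b) monoid_scheme \<Rightarrow> (nat \<Rightarrow> 'v set) \<Rightarrow> 'v set set \<Rightarrow> ('g \<Rightarrow> 'v \<Rightarrow> 'v) \<Rightarrow> bool" where
  "tree_action \<Gamma> V E \<phi> \<longleftrightarrow>
     group_action \<Gamma> (\<Union>l. V l) \<phi> \<and>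
     (\<forall>g \<in> carrier \<Gamma>. (\<forall>l. \<phi> g ` V l = V l) \<and>
        (\<forall>u \<in> (\<Union>l. V l). \<forall>v \<in> (\<Union>l. V l). {\<phi> g u, \<phi> g v} \<in> E \<longleftrightarrow> {u, v} \<in> E))"

definition boundary_action ::
    "(nat \<Rightarrow> 'v set) \<Rightarrow> 'v set set \<Rightarrow> ('g \<Rightarrow> 'v \<Rightarrow> 'v) \<Rightarrow> 'g \<Rightarrow> (nat \<Rightarrow> 'v) \<Rightarrow> (nat \<Rightarrow> 'v)" where
  "boundary_action V E \<phi> g = (\<lambda>w \<in> boundary V E. \<lambda>l. \<phi> g (w l))"

text \<open>The vertices of the tree are taken from the type indicated by the first argument; theorems
  leave that type arbitrary.\<close>

definition d_regular ::
    "'v itself \<Rightarrow> nat \<Rightarrow> ('g, 'b) monoid_scheme \<Rightarrow> 'x topology \<Rightarrow> ('g \<Rightarrow> 'x \<Rightarrow> 'x) \<Rightarrow> bool" where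
  "d_regular _ d \<Gamma> X \<Phi> \<longleftrightarrow>
     (\<exists>(V :: nat \<Rightarrow> 'v set) E \<phi>. d_ary_tree d V E \<and> tree_action \<Gamma> V E \<phi> \<and>
        isomorphic_actions \<Gamma> X \<Phi> \<Gamma> (boundary_topology V E) (boundary_action V E \<phi>))"


section \<open>Group chain models\<close>

definition group_chain :: "('g, 'b) monoid_scheme \<Rightarrow> (nat \<Rightarrow> 'g set) \<Rightarrow> bool" where
  "group_chain \<Gamma> G \<longleftrightarrow>
     G 0 = carrier \<Gamma> \<and>
     (\<forall>l. subgroup (G l) \<Gamma> \<and> finite (lcosets\<^bsub>\<Gamma>\<^esub> (G l)) \<and> G (Suc l) \<subseteq> G l)"

text \<open>The bonding map from level \<open>l + 1\<close> to level \<open>l\<close> sends \<open>a G\<^bsub>l+1\<^esub>\<close> to \<open>a G\<^bsub>l+1\<^esub> G\<^bsub>l\<^esub> = a G\<^bsub>l\<^esub>\<close>.\<close>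

definition chain_limit :: "('g, 'b) monoid_scheme \<Rightarrow> (nat \<Rightarrow> 'g set) \<Rightarrow> (nat \<Rightarrow> 'g set) set" where
  "chain_limit \<Gamma> G =
     {x. \<forall>l. x l \<in> lcosets\<^bsub>\<Gamma>\<^esub> (G l) \<and> x (Suc l) <#>\<^bsub>\<Gamma>\<^esub> G l = x l}"

definition chain_limit_topology ::
    "('g, 'b) monoid_scheme \<Rightarrow> (nat \<Rightarrow> 'g set) \<Rightarrow> (nat \<Rightarrow> 'g set) topology" where
  "chain_limit_topology \<Gamma> G =
     subtopology (product_topology (\<lambda>l. discrete_topology (lcosets\<^bsub>\<Gamma>\<^esub> (G l))) UNIV)
       (chain_limit \<Gamma> G)"

definition chain_limit_action ::
    "('g, 'b) monoid_scheme \<Rightarrow> (nat \<Rightarrow> 'g set) \<Rightarrow> 'g \<Rightarrow> (nat \<Rightarrow> 'g set) \<Rightarrow> (nat \<Rightarrow> 'g set)" where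
  "chain_limit_action \<Gamma> G g = (\<lambda>x \<in> chain_limit \<Gamma> G. \<lambda>l. g <#\<^bsub>\<Gamma>\<^esub> x l)"

definition group_chain_model ::
    "('g, 'b) monoid_scheme \<Rightarrow> 'x topology \<Rightarrow> ('g \<Rightarrow> 'x \<Rightarrow> 'x) \<Rightarrow> (nat \<Rightarrow> 'g set) \<Rightarrow> bool" where
  "group_chain_model \<Gamma> X \<Phi> G \<longleftrightarrow>
     group_chain \<Gamma> G \<and>
     (\<exists>h. homeomorphic_map X (chain_limit_topology \<Gamma> G) h \<and>
       (\<forall>g \<in> carrier \<Gamma>. \<forall>x \<in> topspace X. h (\<Phi> g x) = chain_limit_action \<Gamma> G g (h x)))"

definition chain_core :: "('g, 'b) monoid_scheme \<Rightarrow> (nat \<Rightarrow> 'g set) \<Rightarrow> nat \<Rightarrow> 'g set" where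
  "chain_core \<Gamma> G l = (\<Inter>\<delta> \<in> carrier \<Gamma>. \<delta> <#\<^bsub>\<Gamma>\<^esub> G l #>\<^bsub>\<Gamma>\<^esub> inv\<^bsub>\<Gamma>\<^esub> \<delta>)"


section \<open>Steinitz numbers and types\<close>

text \<open>A Steinitz number is its exponent function on the primes, extended by \<open>0\<close> to the
  non-primes.\<close>

typedef steinitz = "{e :: nat \<Rightarrow> enat. \<forall>p. \<not> prime p \<longrightarrow> e p = 0}"
  morphisms exponent Abs_steinitz
  by auto

setup_lifting type_definition_steinitz

instantiation steinitz :: times
begin

lift_definition times_steinitz :: "steinitz \<Rightarrow> steinitz \<Rightarrow> steinitz"
  is "\<lambda>e e' p. e p + e' p"
  by simp

instance ..

end

text \<open>Only positive integers are ever converted.\<close>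

lift_definition steinitz_of_nat :: "nat \<Rightarrow> steinitz"
  is "\<lambda>m p. if prime p then enat (multiplicity p m) else 0"
  by simp

lift_definition steinitz_Lcm :: "nat set \<Rightarrow> steinitz"
  is "\<lambda>A p. if prime p then (SUP m \<in> A. enat (multiplicity p m)) else 0"
  by simp

definition prime_spectrum :: "steinitz \<Rightarrow> nat set" where
  "prime_spectrum \<xi> = {p. prime p \<and> exponent \<xi> p > 0}"

definition finite_prime_spectrum :: "steinitz \<Rightarrow> nat set" where
  "finite_prime_spectrum \<xi> = {p. prime p \<and> 0 < exponent \<xi> p \<and> exponent \<xi> p < \<infinity>}"

definition infinite_prime_spectrum :: "steinitz \<Rightarrow> nat set" where
  "infinite_prime_spectrum \<xi> = {p. prime p \<and> exponent \<xi> p = \<infinity>}"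

definition asymptotically_equivalent :: "steinitz \<Rightarrow> steinitz \<Rightarrow> bool" where
  "asymptotically_equivalent \<xi> \<xi>' \<longleftrightarrow>
     (\<exists>m \<ge> 1. \<exists>m' \<ge> 1. steinitz_of_nat m * \<xi> = steinitz_of_nat m' * \<xi>')"

definition steinitz_type :: "steinitz \<Rightarrow> steinitz set" where
  "steinitz_type \<xi> = {\<xi>'. asymptotically_equivalent \<xi> \<xi>'}"


section \<open>The typeset\<close>

definition element_order ::
    "('g, 'b) monoid_scheme \<Rightarrow> (nat \<Rightarrow> 'g set) \<Rightarrow> 'g \<Rightarrow> steinitz" where
  "element_order \<Gamma> G \<gamma> =
     steinitz_Lcm
       {order (\<Gamma>\<lparr>carrier := generate \<Gamma> {\<gamma>}\<rparr> Mod (generate \<Gamma> {\<gamma>} \<inter> chain_core \<Gamma> G l)) | l. l > 0}"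

definition chain_typeset ::
    "('g, 'b) monoid_scheme \<Rightarrow> (nat \<Rightarrow> 'g set) \<Rightarrow> steinitz set set" where
  "chain_typeset \<Gamma> G = {steinitz_type (element_order \<Gamma> G \<gamma>) | \<gamma>. \<gamma> \<in> carrier \<Gamma>}"

text \<open>Every odometer has a group chain model, and all its models give the same set of types.\<close>

definition typeset ::
    "('g, 'b) monoid_scheme \<Rightarrow> 'x topology \<Rightarrow> ('g \<Rightarrow> 'x \<Rightarrow> 'x) \<Rightarrow> steinitz set set" where
  "typeset \<Gamma> X \<Phi> = chain_typeset \<Gamma> (SOME G. group_chain_model \<Gamma> X \<Phi> G)"

definition prime_divisors_upto :: "nat \<Rightarrow> nat set" where
  "prime_divisors_upto d = {p. prime p \<and> (\<exists>n \<in> {2..d}. p dvd n)}"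

end

theory Submission
  imports Defs "HOL-Algebra.Multiplicative_Group" "HOL-Algebra.Sylow" "HOL-Algebra.Elementary_Groups"
begin

text \<open>An automorphism of a \<open>d\<close>-ary tree that fixes a level permutes the \<open>d\<close> children of each vertex of
  that level, so its \<open>d!\<close>-th power fixes the next level; hence \<open>\<gamma>\<close> to the power \<open>(d!)\<^sup>n\<close> fixes level
  \<open>n\<close>.  For an arbitrary group chain model the set of points lying in a given coset of \<open>\<Gamma>\<^sub>l\<close> is open,
  so around any of its points it contains the paths through some vertex, and therefore some power
  \<open>(d!)\<^sup>n\<close> of \<open>\<gamma>\<close> fixes all of the finitely many cosets, that is, lies in \<open>C\<^sub>l\<close>.  So only primes
  \<open>p \<le> d\<close> divide \<open>\<xi>(\<gamma>)\<close>.  The finitely many finite exponents do not affect the type, which is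
  thus determined by a subset of \<open>P\<^sub>d\<close>, namely the set of primes with infinite exponent.  A model
  exists: take the stabilizers of the vertices on one path; minimality makes the orbit of the path
  dense, so the cosets at level \<open>l\<close> correspond to the vertices of level \<open>l\<close> on infinite paths.\<close>

section \<open>Steinitz numbers with finite prime spectrum\<close>

lemma exponent_not_prime: "\<not> prime p \<Longrightarrow> exponent \<xi> p = 0"
  using exponent[of \<xi>] by simp

lemma steinitz_eqI:
  assumes "\<And>p. prime p \<Longrightarrow> exponent \<xi> p = exponent \<xi>' p"
  shows "\<xi> = \<xi>'"
proof -
  have "exponent \<xi> = exponent \<xi>'"
    using assms exponent_not_prime by (metis ext)
  then show ?thesis by (simp add: exponent_inject)
qed

lemma exponent_mult: "exponent (\<xi> * \<xi>') p = exponent \<xi> p + exponent \<xi>' p"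
  by transfer simp

lemma exponent_steinitz_of_nat:
  "prime p \<Longrightarrow> exponent (steinitz_of_nat m) p = enat (multiplicity p m)"
  by transfer simp

lemma asymptotically_equivalent_iff:
  "asymptotically_equivalent \<xi> \<xi>' \<longleftrightarrow>
     (\<exists>m \<ge> 1. \<exists>m' \<ge> 1. \<forall>p. prime p \<longrightarrow>
        enat (multiplicity p m) + exponent \<xi> p = enat (multiplicity p m') + exponent \<xi>' p)"
proof -
  have "steinitz_of_nat m * \<xi> = steinitz_of_nat m' * \<xi>' \<longleftrightarrow>
     (\<forall>p. prime p \<longrightarrow>
        enat (multiplicity p m) + exponent \<xi> p = enat (multiplicity p m') + exponent \<xi>' p)" for m m'
    by (metis steinitz_eqI exponent_mult exponent_steinitz_of_nat)
  then show ?thesis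
    by (simp add: asymptotically_equivalent_def)
qed

lemma asymptotically_equivalent_sym:
  "asymptotically_equivalent \<xi> \<xi>' \<Longrightarrow> asymptotically_equivalent \<xi>' \<xi>"
  unfolding asymptotically_equivalent_def by metis

text \<open>The multipliers of the two relations are multiplied crosswise. Exponents are only added,
  never cancelled, because cancellation fails at infinite exponents.\<close>

lemma asymptotically_equivalent_trans:
  assumes "asymptotically_equivalent \<xi> \<xi>'" "asymptotically_equivalent \<xi>' \<xi>''"
  shows "asymptotically_equivalent \<xi> \<xi>''"
proof -
  obtain m m' where m: "m \<ge> 1" "m' \<ge> 1" and e: "\<And>p. prime p \<Longrightarrow>
      enat (multiplicity p m) + exponent \<xi> p = enat (multiplicity p m') + exponent \<xi>' p"
    using assms(1) unfolding asymptotically_equivalent_iff by metis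
  obtain n n' where n: "n \<ge> 1" "n' \<ge> 1" and f: "\<And>p. prime p \<Longrightarrow>
      enat (multiplicity p n) + exponent \<xi>' p = enat (multiplicity p n') + exponent \<xi>'' p"
    using assms(2) unfolding asymptotically_equivalent_iff by metis
  have "enat (multiplicity p (n * m)) + exponent \<xi> p =
      enat (multiplicity p (m' * n')) + exponent \<xi>'' p" if p: "prime p" for p
  proof -
    have "enat (multiplicity p (n * m)) + exponent \<xi> p =
        enat (multiplicity p n) + (enat (multiplicity p m) + exponent \<xi> p)"
      using m n p by (simp add: prime_elem_multiplicity_mult_distrib add.assoc flip: plus_enat_simps(1))
    also have "\<dots> = enat (multiplicity p m') + (enat (multiplicity p n) + exponent \<xi>' p)"
      using e[OF p] by (simp add: ac_simps)
    also have "\<dots> = enat (multiplicity p (m' * n')) + exponent \<xi>'' p"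
      using f[OF p] m n p
      by (simp add: prime_elem_multiplicity_mult_distrib add.assoc flip: plus_enat_simps(1))
    finally show ?thesis .
  qed
  moreover have "n * m \<ge> 1" "m' * n' \<ge> 1" using m n by auto
  ultimately show ?thesis unfolding asymptotically_equivalent_iff by blast
qed

lemma steinitz_type_eq:
  "asymptotically_equivalent \<xi> \<xi>' \<Longrightarrow> steinitz_type \<xi> = steinitz_type \<xi>'"
  unfolding steinitz_type_def
  using asymptotically_equivalent_sym asymptotically_equivalent_trans by blast

text \<open>The product of \<open>p\<close> to the power \<infinity> over the primes
  \<open>p\<close> in \<open>S\<close>; it serves as the normal form of a type with finite prime
  spectrum.\<close>

lift_definition infinite_power :: "nat set \<Rightarrow> steinitz"
  is "\<lambda>S p. if prime p \<and> p \<in> S then \<infinity> else 0"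
  by simp

lemma prime_spectra_infinite_power:
  "finite_prime_spectrum (infinite_power S) = {}"
  "prime_spectrum (infinite_power S) = infinite_prime_spectrum (infinite_power S)"
  unfolding finite_prime_spectrum_def prime_spectrum_def infinite_prime_spectrum_def
  by (transfer; auto)+

text \<open>The finite prime powers in \<open>\<xi>\<close> multiply to a positive integer
  \<open>m\<close>, and \<open>\<xi>\<close> is \<open>m\<close> times its purely infinite
  part.\<close>

lemma steinitz_type_finite_spectrum:
  assumes "finite (prime_spectrum \<xi>)"
  shows "steinitz_type \<xi> = steinitz_type (infinite_power (infinite_prime_spectrum \<xi>))"
proof -
  define F where "F = finite_prime_spectrum \<xi>"
  \<comment> \<open>All exponents on \<open>F\<close> are finite, so \<open>the_enat\<close> returns
    their true values.\<close>
  define m where "m = (\<Prod>p\<in>F. p ^ the_enat (exponent \<xi> p))"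
  have F: "finite F" "\<And>p. p \<in> F \<Longrightarrow> prime p"
    using assms finite_subset[of F "prime_spectrum \<xi>"]
    by (auto simp: F_def finite_prime_spectrum_def prime_spectrum_def)
  have "m \<noteq> 0"
    using F by (auto simp: m_def dest!: F(2))
  have "enat (multiplicity p 1) + exponent \<xi> p =
      enat (multiplicity p m) + exponent (infinite_power (infinite_prime_spectrum \<xi>)) p"
    if p: "prime p" for p
  proof -
    have m: "multiplicity p m = (if p \<in> F then the_enat (exponent \<xi> p) else 0)"
      unfolding m_def using F p by (intro multiplicity_prod_prime_powers) auto
    have i: "exponent (infinite_power S) p = (if p \<in> S then \<infinity> else 0)" for S
      using p by transfer simp
    show ?thesis
      unfolding m i using p
      by (cases "exponent \<xi> p")
        (auto simp: F_def finite_prime_spectrum_def infinite_prime_spectrum_def zero_enat_def)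
  qed
  then have "asymptotically_equivalent \<xi> (infinite_power (infinite_prime_spectrum \<xi>))"
    unfolding asymptotically_equivalent_iff
    using \<open>m \<noteq> 0\<close> by (intro exI[of _ 1] conjI exI[of _ m]) auto
  then show ?thesis by (rule steinitz_type_eq)
qed

text \<open>A nonzero supremum has a nonzero term. The condition \<open>m \<noteq> 0\<close> follows
  from \<open>multiplicity p 0 = 0\<close>; it discards infinite quotients, whose
  \<open>order\<close> is 0, so that the quotients considered later are finite.\<close>

lemma prime_spectrum_Lcm_subset:
  "prime_spectrum (steinitz_Lcm A) \<subseteq> {p. prime p \<and> (\<exists>m\<in>A. m \<noteq> 0 \<and> p dvd m)}"
proof (safe)
  fix p assume "p \<in> prime_spectrum (steinitz_Lcm A)"
  then have p: "prime p" and e: "exponent (steinitz_Lcm A) p \<noteq> 0"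
    by (auto simp: prime_spectrum_def)
  then have "(SUP m \<in> A. enat (multiplicity p m)) \<noteq> 0"
    by transfer simp
  then obtain m where "m \<in> A" "multiplicity p m \<noteq> 0"
    by (metis SUP_bot_conv(1) bot_enat_def zero_enat_def)
  then show "\<exists>m\<in>A. m \<noteq> 0 \<and> p dvd m"
    by (metis multiplicity_zero not_dvd_imp_multiplicity_0)
  show "prime p" by (rule p)
qed

lemma finite_prime_divisors_upto: "finite (prime_divisors_upto d)"
  by (rule finite_subset[of _ "{..d}"]) (auto simp: prime_divisors_upto_def dest: dvd_imp_le)

section \<open>Cosets and cyclic quotients\<close>

text \<open>Cauchy's theorem: some element has order \<open>p\<close>, and the order of an element
  divides every \<open>k\<close> that annihilates it.\<close>

lemma (in group) prime_dvd_order_imp_dvd_exponent: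
  assumes fin: "finite (carrier G)" and p: "prime p" "p dvd order G"
    and k: "\<And>x. x \<in> carrier G \<Longrightarrow> x [^] (k::nat) = \<one>"
  shows "p dvd k"
proof -
  \<comment> \<open>The cofactor \<open>m\<close> may still be divisible by \<open>p\<close>;
    Sylow's theorem in this form yields a subgroup of order \<open>p ^ 1\<close> all the
    same.\<close>
  obtain m where "order G = p ^ 1 * m" using p by auto
  then obtain H where H: "subgroup H G" "card H = p"
    using sylow_thm[OF p(1) is_group _ fin, of 1 m] by auto
  have "card H > 1" using H prime_gt_1_nat[OF p(1)] by simp
  then have "\<not> H \<subseteq> {\<one>}"
    using card_mono[of "{\<one>}" H] by auto
  then obtain x where x: "x \<in> H" "x \<noteq> \<one>" by blast
  interpret H: group "G\<lparr>carrier := H\<rparr>" by (rule subgroup_imp_group[OF H(1)])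
  have xG: "x \<in> carrier G" using x H subgroup.mem_carrier by metis
  have "x [^]\<^bsub>G\<lparr>carrier := H\<rparr>\<^esub> order (G\<lparr>carrier := H\<rparr>) = \<one>"
    using H.pow_order_eq_1[of x] x by simp
  then have "x [^] p = \<one>"
    using H by (simp add: order_def nat_pow_consistent[symmetric])
  then have "ord x dvd p" "ord x dvd k" "ord x \<noteq> 1"
    using k[OF xG] x xG ord_eq_1[OF xG] by (auto simp: pow_eq_id)
  then show ?thesis
    using p(1) by (metis prime_nat_iff)
qed

text \<open>A conjugate of \<open>H\<close> is the stabilizer of a coset under left multiplication,
  since \<open>g \<otimes> \<delta>\<close> lies in \<open>\<delta> <# H\<close> exactly when it
  represents that coset.\<close>

lemma (in group) mem_conjugate_iff:
  assumes H: "subgroup H G" and d: "\<delta> \<in> carrier G"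
  shows "g \<in> \<delta> <# H #> inv \<delta> \<longleftrightarrow> g \<in> carrier G \<and> g <# (\<delta> <# H) = \<delta> <# H"
proof -
  interpret H: subgroup H G by (rule H)
  have "g \<in> \<delta> <# H #> inv \<delta> \<longleftrightarrow> (\<exists>h\<in>H. g = \<delta> \<otimes> h \<otimes> inv \<delta>)"
    by (auto simp: l_coset_def r_coset_def)
  also have "\<dots> \<longleftrightarrow> g \<in> carrier G \<and> (\<exists>h\<in>H. g \<otimes> \<delta> = \<delta> \<otimes> h)"
  proof -
    have "g = \<delta> \<otimes> h \<otimes> inv \<delta> \<longleftrightarrow> g \<in> carrier G \<and> g \<otimes> \<delta> = \<delta> \<otimes> h" if "h \<in> H" for h
      using d that inv_solve_right[of g "\<delta> \<otimes> h" \<delta>] by auto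
    then show ?thesis by blast
  qed
  also have "\<dots> \<longleftrightarrow> g \<in> carrier G \<and> g \<otimes> \<delta> \<in> \<delta> <# H"
    by (auto simp: l_coset_def)
  also have "\<dots> \<longleftrightarrow> g \<in> carrier G \<and> g <# (\<delta> <# H) = \<delta> <# H"
    by (metis H H.subset d l_repr_independence lcos_m_assoc lcos_self m_closed)
  finally show ?thesis .
qed

text \<open>Intersecting the coset stabilizers gives the kernel of left multiplication on the
  cosets. \<open>one_closed\<close> supplies an index of the intersection, which places its members
  in the carrier.\<close>

lemma (in group) chain_core_eq:
  assumes "subgroup (C l) G"
  shows "chain_core G C l = {g \<in> carrier G. \<forall>c \<in> lcosets (C l). g <# c = c}"
  using mem_conjugate_iff[OF assms] one_closed
  by (fastforce simp: chain_core_def LCOSETS_def)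

lemma (in group) subgroup_chain_core:
  assumes "subgroup (C l) G"
  shows "subgroup (chain_core G C l) G"
proof -
  let ?K = "{g \<in> carrier G. \<forall>c \<in> lcosets (C l). g <# c = c}"
  have sub: "c \<subseteq> carrier G" if "c \<in> lcosets (C l)" for c
    by (rule subgroup.lcosets_carrier[OF assms is_group that])
  have "subgroup ?K G"
  proof (rule subgroupI)
    have "\<one> \<in> ?K" using sub lcos_mult_one by blast
    then show "?K \<noteq> {}" by blast
  next
    fix g assume g: "g \<in> ?K"
    have "inv g <# c = c" if c: "c \<in> lcosets (C l)" for c
    proof -
      have "inv g <# c = inv g <# (g <# c)" using g c by simp
      also have "\<dots> = inv g \<otimes> g <# c" using g by (intro lcos_m_assoc sub[OF c]) auto
      also have "\<dots> = c" using g sub[OF c] by (simp add: lcos_mult_one)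
      finally show ?thesis .
    qed
    with g show "inv g \<in> ?K" by blast
  next
    fix g h assume gh: "g \<in> ?K" "h \<in> ?K"
    have "g \<otimes> h <# c = c" if c: "c \<in> lcosets (C l)" for c
    proof -
      have "g \<otimes> h <# c = g <# (h <# c)"
        using gh by (intro lcos_m_assoc[symmetric] sub[OF c]) auto
      also have "\<dots> = c" using gh c by simp
      finally show ?thesis .
    qed
    with gh show "g \<otimes> h \<in> ?K" by blast
  qed blast
  then show ?thesis by (simp add: chain_core_eq[of C, OF assms])
qed

text \<open>The quotient of the cyclic group generated by \<open>g\<close> is annihilated by
  \<open>k\<close>, because \<open>k\<close>-th powers of its elements are powers of
  \<open>g [^] k\<close>. Cauchy's theorem then applies.\<close>

lemma (in group) prime_dvd_order_cyclic_quotient: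
  assumes C: "subgroup C G" and g: "g \<in> carrier G" and k: "g [^] (k::nat) \<in> C"
    and p: "prime p" "p dvd order (G\<lparr>carrier := generate G {g}\<rparr> Mod (generate G {g} \<inter> C))"
    and nz: "order (G\<lparr>carrier := generate G {g}\<rparr> Mod (generate G {g} \<inter> C)) \<noteq> 0"
  shows "p dvd k"
proof -
  define H where "H = generate G {g}"
  have sH: "subgroup H G" using g by (simp add: H_def generate_is_subgroup)
  \<comment> \<open>This identification imports commutativity of cyclic groups, which makes every
    subgroup of \<open>H\<close> normal.\<close>
  have Heq: "G\<lparr>carrier := H\<rparr> = subgroup_generated G {g}"
    using g by (simp add: subgroup_generated_def H_def)
  interpret H: comm_group "G\<lparr>carrier := H\<rparr>"
    unfolding Heq
    by (rule group.cyclic_imp_abelian_group[OF group_subgroup_generated cyclic_group_generated])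
  have "subgroup (H \<inter> C) (G\<lparr>carrier := H\<rparr>)"
    by (rule subgroup_incl[OF subgroups_Inter_pair[OF sH C] sH]) simp
  then interpret N: normal "H \<inter> C" "G\<lparr>carrier := H\<rparr>"
    by (rule H.subgroup_imp_normal)
  let ?Q = "G\<lparr>carrier := H\<rparr> Mod (H \<inter> C)"
  interpret Q: group ?Q by (rule N.factorgroup_is_group)
  have pow: "x [^]\<^bsub>?Q\<^esub> k = \<one>\<^bsub>?Q\<^esub>" if x: "x \<in> carrier ?Q" for x
  proof -
    obtain a where a: "a \<in> H" "x = H \<inter> C #> a"
      using x by (auto simp: carrier_FactGroup)
    obtain i :: int where i: "a = g [^] i"
      using a g by (auto simp: H_def generate_pow)
    \<comment> \<open>Swapping the exponents exhibits the power as an integer power of an element of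
      \<open>C\<close>.\<close>
    have ak: "a [^] k = (g [^] k) [^] i"
      using g by (simp add: i int_pow_pow mult.commute flip: int_pow_int)
    have "a [^] k \<in> C"
      unfolding ak by (rule subgroup_int_pow_closed[OF C k])
    moreover have "a [^] k \<in> H"
      using H.nat_pow_closed[of a k] a by (simp add: nat_pow_consistent[of a k H])
    ultimately have "H \<inter> C #> (a [^] k) = H \<inter> C"
      using C sH by (intro coset_join2 subgroups_Inter_pair) (auto dest: subgroup.mem_carrier)
    then show ?thesis
      using N.FactGroup_pow[of a k] a by (simp add: nat_pow_consistent[of a k H])
  qed
  have "finite (carrier ?Q)"
    using nz unfolding H_def[symmetric] order_def by (metis card.infinite)
  then show ?thesis
    using Q.prime_dvd_order_imp_dvd_exponent[OF _ p(1) _ pow] p(2) by (simp add: H_def)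
qed

section \<open>Trees and their boundaries\<close>

text \<open>The \<open>d + 1\<close> iterates of \<open>x\<close> with indices 0 to \<open>d\<close>
  lie in a set of at most \<open>d\<close> elements, so two coincide. Injectivity cancels the
  smaller index, leaving a positive period of at most \<open>d\<close>, which divides
  \<open>fact d\<close>.\<close>

lemma funpow_fact_fixes:
  assumes inj: "inj_on f A" and im: "f ` A \<subseteq> A" and fin: "finite A" "card A \<le> d" and x: "x \<in> A"
  shows "(f ^^ fact d) x = x"
proof -
  have mem: "(f ^^ i) y \<in> A" if "y \<in> A" for i y
    using that im by (induction i) auto
  have "\<not> inj_on (\<lambda>i. (f ^^ i) x) {..d}"
  proof (rule pigeonhole)
    have "card ((\<lambda>i. (f ^^ i) x) ` {..d}) \<le> card A"
      using mem[OF x] by (intro card_mono fin) auto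
    then show "card ((\<lambda>i. (f ^^ i) x) ` {..d}) < card {..d}"
      using fin by simp
  qed
  then obtain i j where ij: "i < j" "j \<le> d" "(f ^^ i) x = (f ^^ j) x"
    unfolding inj_on_def by (metis atMost_iff nat_neq_iff)
  have inji: "inj_on (f ^^ i) A"
  proof (induction i)
    case (Suc i)
    have "(f ^^ i) ` A \<subseteq> A" using mem by blast
    then show ?case
      using comp_inj_on[OF Suc inj_on_subset[OF inj]] by (simp add: comp_def)
  qed simp
  have "(f ^^ i) x = (f ^^ i) ((f ^^ (j - i)) x)"
    using ij by (simp flip: funpow_add comp_apply[of "f ^^ i" "f ^^ (j - i)"])
  then have p: "(f ^^ (j - i)) x = x"
    using inj_onD[OF inji] mem[OF x] x by metis
  have "(j - i) dvd fact d"
    using ij by (intro dvd_fact) auto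
  then obtain q where "fact d = (j - i) * q" by blast
  moreover have "((f ^^ (j - i)) ^^ q) x = x"
    using p by (induction q) auto
  ultimately show ?thesis
    by (simp add: funpow_mult)
qed

lemma (in group_action) pow_action:
  assumes "g \<in> carrier G" "x \<in> E"
  shows "\<phi> (g [^] (n::nat)) x = (\<phi> g ^^ n) x"
proof -
  interpret group_hom G "BijGroup E" \<phi> by (rule group_hom)
  show ?thesis
  proof (induction n)
    case 0
    then show ?case using assms by (simp add: BijGroup_def)
  next
    case (Suc n)
    have "g [^] Suc n = g \<otimes> g [^] n" by (rule G.nat_pow_Suc2[OF assms(1)])
    then show ?case
      using assms composition_rule[of x "g" "g [^] n"] Suc by simp
  qed
qed

lemma rooted_tree_ex1_parent:
  "rooted_tree V E \<Longrightarrow> v \<in> V (Suc l) \<Longrightarrow> \<exists>!u. u \<in> V l \<and> {u, v} \<in> E"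
  by (simp add: rooted_tree_def)

lemma rooted_tree_parent_unique:
  assumes "rooted_tree V E" "v \<in> V (Suc l)" "u \<in> V l" "u' \<in> V l" "{u, v} \<in> E" "{u', v} \<in> E"
  shows "u = u'"
  using rooted_tree_ex1_parent[OF assms(1,2)] assms(3-6) by blast

text \<open>Each vertex determines its parent, so agreement descends one level at a time from
  \<open>n\<close> to \<open>m\<close>.\<close>

lemma boundary_eq_below:
  assumes "rooted_tree V E" "w \<in> boundary V E" "w' \<in> boundary V E" "w n = w' n" "m \<le> n"
  shows "w m = w' m"
  using assms(5)
proof (induction rule: inc_induct)
  case base
  show ?case by (rule assms(4))
next
  case (step i)
  have w: "{w i, w (Suc i)} \<in> E" "{w' i, w' (Suc i)} \<in> E" "w i \<in> V i" "w' i \<in> V i"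
      "w (Suc i) \<in> V (Suc i)"
    using assms(2,3) by (simp_all add: boundary_def)
  then show ?case
    using rooted_tree_parent_unique[OF assms(1) w(5,3,4,1)] step.IH by simp
qed

section \<open>Topology of the tree boundary and of the inverse limit\<close>

lemma topspace_boundary_topology: "topspace (boundary_topology V E) = boundary V E"
  by (auto simp: boundary_topology_def boundary_def)

lemma topspace_chain_limit_topology: "topspace (chain_limit_topology \<Gamma> C) = chain_limit \<Gamma> C"
  by (auto simp: chain_limit_topology_def chain_limit_def)

lemma continuous_map_boundary_coordinate:
  "continuous_map (boundary_topology V E) (discrete_topology (V l)) (\<lambda>w. w l)"
  unfolding boundary_topology_def
  by (intro continuous_map_from_subtopology continuous_map_product_projection) simp

lemma continuous_map_chain_limit_coordinate:
  "continuous_map (chain_limit_topology \<Gamma> C) (discrete_topology (lcosets\<^bsub>\<Gamma>\<^esub> (C l))) (\<lambda>x. x l)"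
  unfolding chain_limit_topology_def
  using continuous_map_product_projection[of l UNIV "\<lambda>l. discrete_topology (lcosets\<^bsub>\<Gamma>\<^esub> (C l))"]
  by (intro continuous_map_from_subtopology) simp

text \<open>\<open>F\<close> is required to land in \<open>W\<close> only at values attained by
  \<open>f\<close>. This matters for the map from vertices to cosets, which is controlled only at
  vertices lying on infinite paths.\<close>

lemma continuous_map_discrete_compose:
  assumes f: "continuous_map X (discrete_topology U) f" and F: "\<And>x. x \<in> topspace X \<Longrightarrow> F (f x) \<in> W"
  shows "continuous_map X (discrete_topology W) (\<lambda>x. F (f x))"
  unfolding continuous_map_def
proof (intro conjI allI impI)
  show "(\<lambda>x. F (f x)) \<in> topspace X \<rightarrow> topspace (discrete_topology W)" using F by auto
  fix T
  have "{x \<in> topspace X. F (f x) \<in> T} = {x \<in> topspace X. f x \<in> {u \<in> U. F u \<in> T}}"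
    using continuous_map_image_subset_topspace[OF f] by auto
  moreover have "openin X \<dots>"
    by (rule openin_continuous_map_preimage[OF f]) auto
  ultimately show "openin X {x \<in> topspace X. F (f x) \<in> T}" by simp
qed

text \<open>A basic open set restricts finitely many coordinates, and agreement at a level beyond
  all of them forces agreement at each. Stating this for all large \<open>n\<close> allows finitely
  many such conditions to be met at once.\<close>

lemma eventually_cylinder_subset:
  assumes tree: "rooted_tree V E" and W: "openin (boundary_topology V E) W" and w: "w \<in> W"
  shows "\<forall>\<^sub>F n in sequentially. \<forall>w'\<in>boundary V E. w' n = w n \<longrightarrow> w' \<in> W"
proof -
  obtain S where S: "openin (product_topology (\<lambda>l. discrete_topology (V l)) UNIV) S"
      "W = S \<inter> boundary V E"
    using W by (auto simp: boundary_topology_def openin_subtopology)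
  then have "w \<in> S" and wb: "w \<in> boundary V E" using w by auto
  then obtain U where fin: "finite {i. U i \<noteq> V i}"
      and U: "w \<in> Pi\<^sub>E UNIV U" "Pi\<^sub>E UNIV U \<subseteq> S"
    using S(1) unfolding openin_product_topology_alt by auto
  \<comment> \<open>Inserting 0 keeps \<open>Max\<close> meaningful when no coordinate is
    restricted.\<close>
  define N where "N = Max (insert 0 {i. U i \<noteq> V i})"
  have N: "i \<le> N" if "U i \<noteq> V i" for i
    using that fin by (simp add: N_def)
  have "w' \<in> W" if n: "n \<ge> N" and w': "w' \<in> boundary V E" "w' n = w n" for n w'
  proof -
    have "w' i \<in> U i" for i
    proof (cases "U i = V i")
      case True
      then show ?thesis using w' by (simp add: boundary_def)
    next
      case False
      then have "w' i = w i"
        using boundary_eq_below[OF tree w'(1) wb w'(2)] N n by (meson le_trans)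
      then show ?thesis using U(1) by (auto simp: PiE_iff)
    qed
    then show ?thesis using U(2) S(2) w' by auto
  qed
  then show ?thesis
    unfolding eventually_sequentially by blast
qed

section \<open>Automorphisms of the tree\<close>

lemma tree_actionD:
  assumes "tree_action \<Gamma> V E \<phi>" "g \<in> carrier \<Gamma>"
  shows "\<phi> g ` V l = V l" "u \<in> V l \<Longrightarrow> \<phi> g u \<in> V l"
    "u \<in> V l \<Longrightarrow> v \<in> V m \<Longrightarrow> {\<phi> g u, \<phi> g v} \<in> E \<longleftrightarrow> {u, v} \<in> E"
proof -
  have act: "(\<forall>l. \<phi> g ` V l = V l) \<and>
      (\<forall>u \<in> (\<Union>l. V l). \<forall>v \<in> (\<Union>l. V l). {\<phi> g u, \<phi> g v} \<in> E \<longleftrightarrow> {u, v} \<in> E)"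
    by (rule bspec[OF conjunct2[OF assms(1)[unfolded tree_action_def]] assms(2)])
  show im: "\<phi> g ` V l = V l" by (rule conjunct1[OF act, rule_format])
  show "\<phi> g u \<in> V l" if "u \<in> V l" using that im by blast
  show "{\<phi> g u, \<phi> g v} \<in> E \<longleftrightarrow> {u, v} \<in> E" if "u \<in> V l" "v \<in> V m"
    using that by (intro conjunct2[OF act, rule_format]) blast+
qed

text \<open>Automorphisms preserve edges and levels and parents are unique, so they commute with
  taking parents.\<close>

lemma tree_action_parent:
  assumes tree: "rooted_tree V E" and act: "tree_action \<Gamma> V E \<phi>" and g: "g \<in> carrier \<Gamma>"
    and uv: "u \<in> V l" "v \<in> V (Suc l)" "{u, v} \<in> E"
    and uv': "u' \<in> V l" "{u', \<phi> g v} \<in> E"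
  shows "\<phi> g u = u'"
proof (rule rooted_tree_parent_unique[OF tree])
  show "\<phi> g v \<in> V (Suc l)" "\<phi> g u \<in> V l"
    by (rule tree_actionD(2)[OF act g uv(2)] tree_actionD(2)[OF act g uv(1)])+
  show "{\<phi> g u, \<phi> g v} \<in> E"
    using tree_actionD(3)[OF act g uv(1,2)] uv(3) by simp
qed (use uv' in auto)

lemma tree_action_pow_fixes:
  assumes tree: "d_ary_tree d V E" and act: "tree_action \<Gamma> V E \<phi>" and g: "g \<in> carrier \<Gamma>"
    and v: "v \<in> V n"
  shows "\<phi> (g [^]\<^bsub>\<Gamma>\<^esub> (fact d ^ n :: nat)) v = v"
proof -
  have rt: "rooted_tree V E" using tree by (simp add: d_ary_tree_def)
  interpret group_action \<Gamma> "\<Union>l. V l" \<phi> using act by (simp add: tree_action_def)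
  interpret group_hom \<Gamma> "BijGroup (\<Union>l. V l)" \<phi> by (rule group_hom)
  show ?thesis
    using v
  proof (induction n arbitrary: v)
    case 0
    moreover have "card (V 0) = 1" using rt by (simp add: rooted_tree_def)
    ultimately have "V 0 = {v}" by (metis card_1_singletonE singletonD)
    then show ?case using tree_actionD(1)[OF act, of _ 0] g by auto
  next
    case (Suc n)
    define h where "h = g [^]\<^bsub>\<Gamma>\<^esub> (fact d ^ n :: nat)"
    have h: "h \<in> carrier \<Gamma>" using g by (simp add: h_def)
    obtain u where u: "u \<in> V n" "{u, v} \<in> E"
      using rooted_tree_ex1_parent[OF rt Suc.prems] by blast
    have hu: "\<phi> h u = u" using Suc.IH[OF u(1)] by (simp add: h_def)
    \<comment> \<open>The children of \<open>u\<close>: since \<open>h\<close> fixes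
      \<open>u\<close>, it maps this set of \<open>d\<close> vertices into itself.\<close>
    define A where "A = {v \<in> V (Suc n). {u, v} \<in> E}"
    have "card A = d"
      using tree[unfolded d_ary_tree_def, THEN conjunct2, rule_format, of "Suc n" u] u(1)
      by (simp add: A_def)
    moreover have "finite A" using rt by (simp add: A_def rooted_tree_def)
    moreover have "inj_on (\<phi> h) A"
      by (rule inj_on_subset[OF inj_prop[OF h]]) (auto simp: A_def)
    moreover have "\<phi> h ` A \<subseteq> A"
    proof (safe)
      fix a assume "a \<in> A"
      then have a: "a \<in> V (Suc n)" "{u, a} \<in> E" by (auto simp: A_def)
      then have "{u, \<phi> h a} \<in> E" "\<phi> h a \<in> V (Suc n)"
        using tree_actionD(3)[OF act h u(1) a(1)] tree_actionD(2)[OF act h a(1)] hu by simp_all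
      then show "\<phi> h a \<in> A" by (simp add: A_def)
    qed
    moreover have "v \<in> A" using u Suc.prems by (simp add: A_def)
    ultimately have "(\<phi> h ^^ fact d) v = v"
      by (intro funpow_fact_fixes[of "\<phi> h" A]) simp_all
    moreover have "\<phi> (h [^]\<^bsub>\<Gamma>\<^esub> (fact d :: nat)) v = (\<phi> h ^^ fact d) v"
      using h Suc.prems by (intro pow_action) auto
    moreover have "g [^]\<^bsub>\<Gamma>\<^esub> (fact d ^ Suc n :: nat) = h [^]\<^bsub>\<Gamma>\<^esub> (fact d :: nat)"
      using g by (simp add: h_def G.nat_pow_pow mult.commute)
    ultimately show ?case by simp
  qed
qed

section \<open>Group chain models of regular odometers\<close>

text \<open>Evaluates the bonding map of the inverse limit on a coset with a given
  representative.\<close>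

lemma (in group) lcoset_set_mult:
  assumes H: "subgroup H G" and K: "subgroup K G" and sub: "H \<subseteq> K" and a: "a \<in> carrier G"
  shows "(a <# H) <#> K = a <# K"
proof -
  have "H <#> K = K"
  proof
    show "H <#> K \<subseteq> K"
      using sub subgroup.m_closed[OF K] by (auto simp: set_mult_def)
    show "K \<subseteq> H <#> K"
    proof
      fix k assume k: "k \<in> K"
      then have "k = \<one> \<otimes> k" using subgroup.mem_carrier[OF K] by simp
      with k subgroup.one_closed[OF H] show "k \<in> H <#> K"
        unfolding set_mult_def by blast
    qed
  qed
  then show ?thesis
    using setmult_lcos_assoc[OF subgroup.subset[OF H] subgroup.subset[OF K] a] by simp
qed

text \<open>The orbit-stabilizer correspondence in the form used to match cosets with vertices: a
  coset is a fiber of the orbit map.\<close>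

lemma (in group_action) lcoset_stabilizer:
  assumes x: "x \<in> E" and a: "a \<in> carrier G"
  shows "a <# stabilizer G \<phi> x = {g \<in> carrier G. \<phi> g x = \<phi> a x}"
proof -
  interpret group_hom G "BijGroup E" \<phi> by (rule group_hom)
  show ?thesis
  proof (intro subset_antisym subsetI)
    fix g assume "g \<in> a <# stabilizer G \<phi> x"
    then obtain s where "s \<in> carrier G" "\<phi> s x = x" "g = a \<otimes> s"
      by (auto simp: l_coset_def stabilizer_def)
    then show "g \<in> {g \<in> carrier G. \<phi> g x = \<phi> a x}"
      using composition_rule[OF x a] a by simp
  next
    fix g assume g: "g \<in> {g \<in> carrier G. \<phi> g x = \<phi> a x}"
    then have "\<phi> (inv a \<otimes> g) x = \<phi> (inv a) (\<phi> g x)"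
      using a by (intro composition_rule x) auto
    also have "\<dots> = \<phi> (inv a) (\<phi> a x)"
      using g by simp
    also have "\<dots> = \<phi> (inv a \<otimes> a) x"
      using a by (intro composition_rule[symmetric] x) auto
    also have "\<dots> = x"
      using a x by (simp add: BijGroup_def)
    finally have "inv a \<otimes> g \<in> stabilizer G \<phi> x"
      using g a by (simp add: stabilizer_def)
    moreover have "g = a \<otimes> (inv a \<otimes> g)"
      using g a by (simp add: G.m_assoc[symmetric])
    ultimately show "g \<in> a <# stabilizer G \<phi> x"
      unfolding l_coset_def by blast
  qed
qed

text \<open>Fixes one conjugacy of the action with a tree boundary. Equivariance is stated vertex by
  vertex with the same group element on both sides, so neither the restriction in
  \<open>boundary_action\<close> nor a group automorphism appears.\<close>

locale tree_model = group \<Gamma> for \<Gamma> :: "('g, 'b) monoid_scheme" (structure) +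
  fixes X :: "'x topology" and \<Phi> :: "'g \<Rightarrow> 'x \<Rightarrow> 'x"
    and d :: nat and V :: "nat \<Rightarrow> 'v set" and E :: "'v set set" and \<phi> :: "'g \<Rightarrow> 'v \<Rightarrow> 'v"
    and h :: "'x \<Rightarrow> nat \<Rightarrow> 'v"
  assumes tree: "d_ary_tree d V E"
    and tree_act: "tree_action \<Gamma> V E \<phi>"
    and X_act: "group_action \<Gamma> (topspace X) \<Phi>"
    and homeo: "homeomorphic_map X (boundary_topology V E) h"
    and equivariant: "g \<in> carrier \<Gamma> \<Longrightarrow> x \<in> topspace X \<Longrightarrow> h (\<Phi> g x) l = \<phi> g (h x l)"
begin

lemma rooted: "rooted_tree V E"
  using tree by (simp add: d_ary_tree_def)

sublocale T: group_action \<Gamma> "\<Union>l. V l" \<phi>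
  using tree_act by (simp add: tree_action_def)

lemma action_closed: "g \<in> carrier \<Gamma> \<Longrightarrow> x \<in> topspace X \<Longrightarrow> \<Phi> g x \<in> topspace X"
  using group_action.element_image[OF X_act] by blast

lemma h_image: "h ` topspace X = boundary V E"
  using homeomorphic_imp_surjective_map[OF homeo] by (simp add: topspace_boundary_topology)

lemma h_boundary: "x \<in> topspace X \<Longrightarrow> h x \<in> boundary V E"
  using h_image by blast

text \<open>The model is arbitrary because \<open>typeset\<close> is computed from an unspecified
  one. Its only link to the tree is topological, through \<open>X\<close>.\<close>

lemma eventually_pow_fixes_coset:
  assumes model: "group_chain_model \<Gamma> X \<Phi> C" and g: "g \<in> carrier \<Gamma>" and c: "c \<in> lcosets (C l)"
  shows "\<forall>\<^sub>F n in sequentially. g [^] (fact d ^ n :: nat) <# c = c"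
proof -
  obtain k where k: "homeomorphic_map X (chain_limit_topology \<Gamma> C) k"
    and eq: "\<And>g x. g \<in> carrier \<Gamma> \<Longrightarrow> x \<in> topspace X \<Longrightarrow> k (\<Phi> g x) = chain_limit_action \<Gamma> C g (k x)"
    and chain: "group_chain \<Gamma> C"
    using model unfolding group_chain_model_def by blast
  have C: "subgroup (C j) \<Gamma>" "C (Suc j) \<subseteq> C j" for j
    using chain unfolding group_chain_def by blast+
  have k_image: "k ` topspace X = chain_limit \<Gamma> C"
    using homeomorphic_imp_surjective_map[OF k] by (simp add: topspace_chain_limit_topology)
  obtain a where a: "a \<in> carrier \<Gamma>" "c = a <# C l"
    using c by (auto simp: LCOSETS_def)
  \<comment> \<open>A single representative used at every level gives a point of the limit whose
    coordinate at level \<open>l\<close> is \<open>c\<close>.\<close>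
  have lim: "(\<lambda>j. a <# C j) \<in> chain_limit \<Gamma> C"
    using a(1) lcoset_set_mult[OF C(1) C(1) C(2) a(1)]
    by (auto simp: chain_limit_def LCOSETS_def)
  then obtain x where x: "x \<in> topspace X" "k x = (\<lambda>j. a <# C j)"
    using k_image by (metis imageE)
  define W where "W = {y \<in> topspace X. k y l \<in> {c}}"
  have "continuous_map X (discrete_topology (lcosets (C l))) (\<lambda>y. k y l)"
    using continuous_map_compose[OF homeomorphic_imp_continuous_map[OF k]
        continuous_map_chain_limit_coordinate[of \<Gamma> C l]] by (simp add: comp_def)
  then have "openin X W"
    unfolding W_def by (rule openin_continuous_map_preimage) (use c in auto)
  then have "openin (boundary_topology V E) (h ` W)"
    using homeomorphic_map_openness[OF homeo, of W] by (auto simp: W_def)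
  moreover have "h x \<in> h ` W"
    using x a by (auto simp: W_def)
  ultimately have "\<forall>\<^sub>F n in sequentially. \<forall>w'\<in>boundary V E. w' n = h x n \<longrightarrow> w' \<in> h ` W"
    by (rule eventually_cylinder_subset[OF rooted])
  then show ?thesis
  proof (rule eventually_mono)
    fix n assume n: "\<forall>w'\<in>boundary V E. w' n = h x n \<longrightarrow> w' \<in> h ` W"
    define g' where "g' = g [^] (fact d ^ n :: nat)"
    have g': "g' \<in> carrier \<Gamma>" using g by (simp add: g'_def)
    have gx: "\<Phi> g' x \<in> topspace X" by (rule action_closed[OF g' x(1)])
    have "h x n \<in> V n" using h_boundary[OF x(1)] by (simp add: boundary_def)
    then have "h (\<Phi> g' x) n = h x n"
      using tree_action_pow_fixes[OF tree tree_act g] equivariant[OF g' x(1)] by (simp add: g'_def)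
    then have "h (\<Phi> g' x) \<in> h ` W"
      using n h_boundary[OF gx] by blast
    then have "\<Phi> g' x \<in> W"
      using homeomorphic_imp_injective_map[OF homeo] gx
      by (auto simp: W_def dest: inj_onD)
    then have "k (\<Phi> g' x) l = c" by (simp add: W_def)
    moreover have "k (\<Phi> g' x) l = g' <# c"
      using eq[OF g' x(1)] x(2) lim a(2) by (simp add: chain_limit_action_def)
    ultimately show "g' <# c = c" by simp
  qed
qed

text \<open>There are finitely many cosets at level \<open>l\<close>, so one exponent serves all of
  them.\<close>

lemma ex_pow_in_chain_core:
  assumes model: "group_chain_model \<Gamma> X \<Phi> C" and g: "g \<in> carrier \<Gamma>"
  shows "\<exists>n. g [^] (fact d ^ n :: nat) \<in> chain_core \<Gamma> C l"
proof -
  have C: "subgroup (C l) \<Gamma>" "finite (lcosets (C l))"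
    using model unfolding group_chain_model_def group_chain_def by blast+
  have "\<forall>\<^sub>F n in sequentially. \<forall>c \<in> lcosets (C l). g [^] (fact d ^ n :: nat) <# c = c"
    using eventually_pow_fixes_coset[OF model g] by (intro eventually_ball_finite C(2)) blast
  then obtain n where "\<forall>c \<in> lcosets (C l). g [^] (fact d ^ n :: nat) <# c = c"
    by (auto simp: eventually_sequentially)
  then show ?thesis
    using g by (auto simp: chain_core_eq[of C, OF C(1)])
qed

lemma prime_spectrum_element_order:
  assumes model: "group_chain_model \<Gamma> X \<Phi> C" and g: "g \<in> carrier \<Gamma>"
  shows "prime_spectrum (element_order \<Gamma> C g) \<subseteq> prime_divisors_upto d"
proof
  fix p assume "p \<in> prime_spectrum (element_order \<Gamma> C g)"
  then obtain l where p: "prime p"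
    and o: "order (\<Gamma>\<lparr>carrier := generate \<Gamma> {g}\<rparr> Mod (generate \<Gamma> {g} \<inter> chain_core \<Gamma> C l)) \<noteq> 0"
      "p dvd order (\<Gamma>\<lparr>carrier := generate \<Gamma> {g}\<rparr> Mod (generate \<Gamma> {g} \<inter> chain_core \<Gamma> C l))"
    unfolding element_order_def using prime_spectrum_Lcm_subset by blast
  have C: "subgroup (C l) \<Gamma>"
    using model unfolding group_chain_model_def group_chain_def by blast
  obtain n where "g [^] (fact d ^ n :: nat) \<in> chain_core \<Gamma> C l"
    using ex_pow_in_chain_core[OF model g] by blast
  then have "p dvd fact d ^ n"
    by (rule prime_dvd_order_cyclic_quotient[OF subgroup_chain_core[of C, OF C] g _ p o(2,1)])
  \<comment> \<open>A prime dividing a power of \<open>fact d\<close> divides \<open>fact d\<close>,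
    hence is at most \<open>d\<close>; it is then its own witness in \<open>{2..d}\<close>.\<close>
  then have "p \<le> d"
    using p prime_dvd_power prime_dvd_fact_iff by blast
  with p show "p \<in> prime_divisors_upto d"
    using prime_ge_2_nat[OF p] by (auto simp: prime_divisors_upto_def intro!: bexI[of _ p])
qed

lemma ex_group_chain_model:
  assumes minimal: "minimal_action \<Gamma> X \<Phi>" and ne: "topspace X \<noteq> {}"
  shows "\<exists>C. group_chain_model \<Gamma> X \<Phi> C"
proof -
  obtain x0 where x0: "x0 \<in> topspace X" using ne by blast
  define w where "w = h x0"
  have wB: "w \<in> boundary V E" unfolding w_def by (rule h_boundary[OF x0])
  have wV: "w l \<in> V l" and wE: "{w l, w (Suc l)} \<in> E" for l
    using wB by (auto simp: boundary_def)
  have wT: "w l \<in> (\<Union>l. V l)" for l using wV by blast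
  define C where "C l = stabilizer \<Gamma> \<phi> (w l)" for l
  have C_sub: "subgroup (C l) \<Gamma>" for l
    unfolding C_def by (rule T.stabilizer_subgroup[OF wT])
  have coset: "a <# C l = {g \<in> carrier \<Gamma>. \<phi> g (w l) = \<phi> a (w l)}" if "a \<in> carrier \<Gamma>" for a l
    unfolding C_def by (rule T.lcoset_stabilizer[OF wT that])
  have parent: "\<phi> a (w l) = w' l"
    if a: "a \<in> carrier \<Gamma>" and w': "w' \<in> boundary V E" and e: "\<phi> a (w (Suc l)) = w' (Suc l)" for a w' l
    using tree_action_parent[OF rooted tree_act a wV wV wE, of "w' l"] w' e
    by (simp add: boundary_def)
  have C_desc: "C (Suc l) \<subseteq> C l" for l
    using parent[OF _ wB] by (auto simp: C_def stabilizer_def)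
  \<comment> \<open>The points whose path passes through \<open>w' l\<close> form an open set, which
    the dense orbit of \<open>x0\<close> meets. Hence the group is transitive on the vertices of
    level \<open>l\<close> that lie on infinite paths.\<close>
  have dense: "\<exists>g \<in> carrier \<Gamma>. \<phi> g (w l) = w' l" if w': "w' \<in> boundary V E" for w' l
  proof -
    obtain x where x: "x \<in> topspace X" "h x = w'" using w' h_image by (metis imageE)
    define W where "W = {y \<in> topspace X. h y l \<in> {w' l}}"
    have "continuous_map X (discrete_topology (V l)) (\<lambda>y. h y l)"
      using continuous_map_compose[OF homeomorphic_imp_continuous_map[OF homeo]
          continuous_map_boundary_coordinate[of V E l]] by (simp add: comp_def)
    then have "openin X W"
      unfolding W_def by (rule openin_continuous_map_preimage) (use w' in \<open>auto simp: boundary_def\<close>)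
    moreover have "x \<in> W" using x by (simp add: W_def)
    moreover have "x \<in> X closure_of orbit \<Gamma> \<Phi> x0"
      using minimal x0 x(1) by (simp add: minimal_action_def)
    ultimately obtain y where "y \<in> orbit \<Gamma> \<Phi> x0" "y \<in> W"
      by (meson in_closure_of)
    then show ?thesis
      using equivariant x0 by (auto simp: orbit_def W_def w_def)
  qed
  \<comment> \<open>A path goes to the sequence of sets of elements carrying \<open>w l\<close> to
    its vertex at level \<open>l\<close>; by \<open>coset\<close> and \<open>dense\<close> these
    sets are cosets of \<open>C l\<close>.\<close>
  define k where "k w' = (\<lambda>l. {g \<in> carrier \<Gamma>. \<phi> g (w l) = w' l})" for w'
  \<comment> \<open>The inverse moves \<open>w l\<close> by any representative; all members of a
    coset of \<open>C l\<close> agree there, so the choice is immaterial.\<close>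
  define k' where "k' x = (\<lambda>l. \<phi> (SOME a. a \<in> x l) (w l))" for x
  have k_coset: "k w' l = a <# C l" if "a \<in> carrier \<Gamma>" "\<phi> a (w l) = w' l" for a l w'
    using that coset[OF that(1)] by (simp add: k_def)
  have k_mem: "k w' l \<in> lcosets (C l)" if w': "w' \<in> boundary V E" for w' l
    using dense[OF w', of l] k_coset by (auto simp: LCOSETS_def)
  have k_limit: "k w' \<in> chain_limit \<Gamma> C" if w': "w' \<in> boundary V E" for w'
  proof -
    have "k w' (Suc l) <#> C l = k w' l" for l
    proof -
      obtain a where a: "a \<in> carrier \<Gamma>" "\<phi> a (w (Suc l)) = w' (Suc l)"
        using dense[OF w'] by blast
      show ?thesis
        unfolding k_coset[of a "Suc l" w', OF a] k_coset[of a l w', OF a(1) parent[OF a(1) w' a(2)]]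
        by (rule lcoset_set_mult[OF C_sub C_sub C_desc a(1)])
    qed
    then show ?thesis using k_mem[OF w'] by (simp add: chain_limit_def)
  qed
  have k'_k: "k' (k w') = w'" if w': "w' \<in> boundary V E" for w'
  proof
    fix l
    have "\<exists>a. a \<in> k w' l" using dense[OF w', of l] by (auto simp: k_def)
    then have "(SOME a. a \<in> k w' l) \<in> k w' l" by (rule someI_ex)
    then show "k' (k w') l = w' l" by (simp add: k'_def k_def)
  qed
  have limit_eq: "x l = {g \<in> carrier \<Gamma>. \<phi> g (w l) = k' x l}" "x l \<noteq> {}"
    if x: "x \<in> chain_limit \<Gamma> C" for x l
  proof -
    have "x l \<in> lcosets (C l)" using x by (simp add: chain_limit_def)
    then obtain a where a: "a \<in> carrier \<Gamma>" "x l = {g \<in> carrier \<Gamma>. \<phi> g (w l) = \<phi> a (w l)}"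
      using coset by (auto simp: LCOSETS_def)
    then have ax: "a \<in> x l" by simp
    then show "x l \<noteq> {}" by blast
    have "(SOME a. a \<in> x l) \<in> x l" using ax by (rule someI)
    then have "k' x l = \<phi> a (w l)" using a by (simp add: k'_def)
    then show "x l = {g \<in> carrier \<Gamma>. \<phi> g (w l) = k' x l}" using a by simp
  qed
  have k_k': "k (k' x) = x" if "x \<in> chain_limit \<Gamma> C" for x
    using limit_eq(1)[OF that] by (auto simp: k_def)
  have k'_boundary: "k' x \<in> boundary V E" if x: "x \<in> chain_limit \<Gamma> C" for x
  proof -
    have "k' x l \<in> V l \<and> {k' x l, k' x (Suc l)} \<in> E" for l
    proof -
      obtain a where a: "a \<in> x (Suc l)" using limit_eq(2)[OF x] by blast
      then have aG: "a \<in> carrier \<Gamma>" and a1: "\<phi> a (w (Suc l)) = k' x (Suc l)"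
        using limit_eq(1)[OF x, of "Suc l"] by auto
      \<comment> \<open>As \<open>C l\<close> contains the identity, \<open>a\<close> also lies in
        the coset at level \<open>l\<close>. One element thus represents both levels and carries an
        edge of \<open>w\<close> to the required edge.\<close>
      have "a \<otimes> \<one> \<in> x (Suc l) <#> C l"
        using a subgroup.one_closed[OF C_sub] unfolding set_mult_def by blast
      then have "a \<in> x l" using x aG by (simp add: chain_limit_def)
      then have a0: "\<phi> a (w l) = k' x l" using limit_eq(1)[OF x, of l] by auto
      show ?thesis
        using tree_actionD(2)[OF tree_act aG wV[of l]] wE[of l]
          tree_actionD(3)[OF tree_act aG wV[of l] wV[of "Suc l"]] a0 a1 by simp
    qed
    then show ?thesis by (simp add: boundary_def)
  qed
  have "continuous_map (boundary_topology V E) (chain_limit_topology \<Gamma> C) k"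
    unfolding chain_limit_topology_def
  proof (intro continuous_map_into_subtopology)
    show "continuous_map (boundary_topology V E)
        (product_topology (\<lambda>l. discrete_topology (lcosets (C l))) UNIV) k"
      unfolding continuous_map_componentwise_UNIV
    proof
      fix l
      show "continuous_map (boundary_topology V E) (discrete_topology (lcosets (C l))) (\<lambda>w'. k w' l)"
        unfolding k_def
        by (rule continuous_map_discrete_compose[OF continuous_map_boundary_coordinate])
          (use k_mem in \<open>simp add: k_def topspace_boundary_topology\<close>)
    qed
  qed (use k_limit in \<open>auto simp: topspace_boundary_topology\<close>)
  moreover have "continuous_map (chain_limit_topology \<Gamma> C) (boundary_topology V E) k'"
    unfolding boundary_topology_def
  proof (intro continuous_map_into_subtopology)
    show "continuous_map (chain_limit_topology \<Gamma> C)
        (product_topology (\<lambda>l. discrete_topology (V l)) UNIV) k'"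
      unfolding continuous_map_componentwise_UNIV
    proof
      fix l
      show "continuous_map (chain_limit_topology \<Gamma> C) (discrete_topology (V l)) (\<lambda>x. k' x l)"
        unfolding k'_def
        by (rule continuous_map_discrete_compose[OF continuous_map_chain_limit_coordinate])
          (use k'_boundary in \<open>simp add: k'_def topspace_chain_limit_topology boundary_def\<close>)
    qed
  qed (use k'_boundary in \<open>auto simp: topspace_chain_limit_topology\<close>)
  ultimately have "homeomorphic_maps (boundary_topology V E) (chain_limit_topology \<Gamma> C) k k'"
    using k'_k k_k'
    by (simp add: homeomorphic_maps_def topspace_boundary_topology topspace_chain_limit_topology)
  then have homeo_k: "homeomorphic_map X (chain_limit_topology \<Gamma> C) (k \<circ> h)"
    using homeomorphic_map_compose[OF homeo] homeomorphic_maps_imp_map by blast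
  have "k (h (\<Phi> g x)) = chain_limit_action \<Gamma> C g (k (h x))"
    if g: "g \<in> carrier \<Gamma>" and x: "x \<in> topspace X" for g x
  proof -
    have "k (h (\<Phi> g x)) l = g <# k (h x) l" for l
    proof -
      obtain a where a: "a \<in> carrier \<Gamma>" "\<phi> a (w l) = h x l"
        using dense[OF h_boundary[OF x]] by blast
      have "\<phi> (g \<otimes> a) (w l) = h (\<Phi> g x) l"
        using T.composition_rule[OF wT g a(1)] a(2) equivariant[OF g x] by simp
      then have "k (h (\<Phi> g x)) l = (g \<otimes> a) <# C l"
        using g a by (intro k_coset) auto
      also have "\<dots> = g <# (a <# C l)"
        using g a by (intro lcos_m_assoc[symmetric] subgroup.subset[OF C_sub]) auto
      also have "\<dots> = g <# k (h x) l"
        using k_coset[of a l "h x", OF a] by simp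
      finally show ?thesis .
    qed
    then show ?thesis
      using k_limit[OF h_boundary[OF x]] by (auto simp: chain_limit_action_def)
  qed
  moreover have "group_chain \<Gamma> C"
    unfolding group_chain_def
  proof (intro conjI allI)
    have "card (V 0) = 1" using rooted by (simp add: rooted_tree_def)
    then obtain r where "V 0 = {r}" by (rule card_1_singletonE)
    then show "C 0 = carrier \<Gamma>"
      using wV[of 0] tree_actionD(2)[OF tree_act _ wV[of 0]] by (auto simp: C_def stabilizer_def)
    fix l
    \<comment> \<open>Cosets are indexed by the images of \<open>w l\<close>, which lie in the
      finite level \<open>V l\<close>.\<close>
    have "lcosets (C l) \<subseteq> (\<lambda>v. {g \<in> carrier \<Gamma>. \<phi> g (w l) = v}) ` V l"
      using coset tree_actionD(2)[OF tree_act _ wV[of l]] by (fastforce simp: LCOSETS_def)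
    moreover have "finite (V l)" using rooted by (simp add: rooted_tree_def)
    ultimately show "finite (lcosets (C l))" by (meson finite_imageI finite_subset)
  qed (rule C_sub C_desc)+
  ultimately have "group_chain_model \<Gamma> X \<Phi> C"
    unfolding group_chain_model_def using homeo_k by (auto intro!: exI[of _ "k \<circ> h"])
  then show ?thesis by blast
qed

text \<open>Existence of a model is what makes the \<open>SOME\<close> in \<open>typeset\<close>
  denote one; the spectrum bound, valid for every model, then applies to it.\<close>

lemma typeset_model:
  assumes "minimal_action \<Gamma> X \<Phi>" "topspace X \<noteq> {}" and \<tau>: "\<tau> \<in> typeset \<Gamma> X \<Phi>"
  shows "\<exists>S \<subseteq> prime_divisors_upto d. \<tau> = steinitz_type (infinite_power S)"
proof -
  define C where "C = (SOME C. group_chain_model \<Gamma> X \<Phi> C)"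
  have model: "group_chain_model \<Gamma> X \<Phi> C"
    unfolding C_def by (rule someI_ex[OF ex_group_chain_model[OF assms(1,2)]])
  obtain g where g: "g \<in> carrier \<Gamma>" "\<tau> = steinitz_type (element_order \<Gamma> C g)"
    using \<tau> unfolding typeset_def chain_typeset_def C_def by blast
  let ?\<xi> = "element_order \<Gamma> C g"
  have sub: "prime_spectrum ?\<xi> \<subseteq> prime_divisors_upto d"
    by (rule prime_spectrum_element_order[OF model g(1)])
  then have "finite (prime_spectrum ?\<xi>)"
    using finite_prime_divisors_upto finite_subset by blast
  then have "\<tau> = steinitz_type (infinite_power (infinite_prime_spectrum ?\<xi>))"
    using g(2) steinitz_type_finite_spectrum by simp
  moreover have "infinite_prime_spectrum ?\<xi> \<subseteq> prime_divisors_upto d"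
    using sub by (auto simp: infinite_prime_spectrum_def prime_spectrum_def)
  ultimately show ?thesis by blast
qed

end

text \<open>The automorphism \<open>\<Theta>\<close> in an isomorphism of actions is absorbed into the tree action.\<close>

lemma d_regular_imp_tree_model:
  assumes reg: "d_regular TYPE('v) d \<Gamma> X \<Phi>" and act: "group_action \<Gamma> (topspace X) \<Phi>"
  shows "\<exists>(V :: nat \<Rightarrow> 'v set) E \<phi> h. tree_model \<Gamma> X \<Phi> d V E \<phi> h"
proof -
  obtain V :: "nat \<Rightarrow> 'v set" and E \<phi> h \<Theta>
    where tree: "d_ary_tree d V E" and ta: "tree_action \<Gamma> V E \<phi>"
      and h: "homeomorphic_map X (boundary_topology V E) h" and \<Theta>: "\<Theta> \<in> iso \<Gamma> \<Gamma>"
      and eq: "\<And>g x. g \<in> carrier \<Gamma> \<Longrightarrow> x \<in> topspace X \<Longrightarrow>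
        h (\<Phi> g x) = boundary_action V E \<phi> (\<Theta> g) (h x)"
    using reg unfolding d_regular_def isomorphic_actions_def by blast
  have \<Theta>_hom: "\<Theta> \<in> hom \<Gamma> \<Gamma>" using \<Theta> by (simp add: iso_def)
  have \<Theta>_closed: "\<Theta> g \<in> carrier \<Gamma>" if "g \<in> carrier \<Gamma>" for g
    using \<Theta>_hom that by (rule hom_in_carrier)
  interpret T: group_action \<Gamma> "\<Union>l. V l" \<phi> using ta by (simp add: tree_action_def)
  interpret H: group_hom \<Gamma> "BijGroup (\<Union>l. V l)" \<phi> by (rule T.group_hom)
  have "\<phi> \<circ> \<Theta> \<in> hom \<Gamma> (BijGroup (\<Union>l. V l))"
    by (rule Group.hom_compose[OF \<Theta>_hom H.homh])
  then have "group_action \<Gamma> (\<Union>l. V l) (\<phi> \<circ> \<Theta>)"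
    by (intro group_action.intro group_hom.intro group_hom_axioms.intro H.G.is_group H.H.is_group)
  then have "tree_action \<Gamma> V E (\<phi> \<circ> \<Theta>)"
    unfolding tree_action_def using tree_actionD[OF ta \<Theta>_closed] by fastforce
  moreover have "h (\<Phi> g x) l = (\<phi> \<circ> \<Theta>) g (h x l)" if "g \<in> carrier \<Gamma>" "x \<in> topspace X" for g x l
  proof -
    have "h x \<in> boundary V E"
      using homeomorphic_imp_surjective_map[OF h] that(2) by (auto simp: topspace_boundary_topology)
    then show ?thesis using eq[OF that] by (simp add: boundary_action_def)
  qed
  ultimately have "tree_model \<Gamma> X \<Phi> d V E (\<phi> \<circ> \<Theta>) h"
    by (intro tree_model.intro tree_model_axioms.intro H.G.is_group tree act h) auto
  then show ?thesis by blast
qed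

theorem theorem1p11:
  fixes \<Gamma> :: "('g, 'b) monoid_scheme"
    and X :: "'x topology"
    and \<Phi> :: "'g \<Rightarrow> 'x \<Rightarrow> 'x"
    and d N :: nat
  assumes "odometer \<Gamma> X \<Phi>"
    and "d \<ge> 2"
    and "d_regular TYPE('v) d \<Gamma> X \<Phi>"
    and "N = card (prime_divisors_upto d)"
  shows "finite (typeset \<Gamma> X \<Phi>) \<and>
    card (typeset \<Gamma> X \<Phi>) \<le> (\<Sum>k = 0..N. N choose k) \<and>
    real (\<Sum>k = 0..N. N choose k) = (\<Sum>k = 0..N. fact N / (fact (N - k) * fact k)) \<and>
    (\<forall>\<tau> \<in> typeset \<Gamma> X \<Phi>. \<exists>\<xi>. \<tau> = steinitz_type \<xi> \<and>
           finite_prime_spectrum \<xi> = {} \<and>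
           prime_spectrum \<xi> = infinite_prime_spectrum \<xi>)"
proof -
  let ?P = "prime_divisors_upto d"
  have minimal: "minimal_action \<Gamma> X \<Phi>" and act: "group_action \<Gamma> (topspace X) \<Phi>"
    and cantor: "cantor_space X"
    using assms(1) by (auto simp: odometer_def cantor_action_def)
  obtain f where f:
    "homeomorphic_map X (product_topology (\<lambda>_ :: nat. discrete_topology (UNIV :: bool set)) UNIV) f"
    using cantor unfolding cantor_space_def homeomorphic_space by blast
  \<comment> \<open>The Cantor space is nonempty, which supplies the base point for the
    model.\<close>
  have "f ` topspace X = UNIV"
    using homeomorphic_imp_surjective_map[OF f] by simp
  then have ne: "topspace X \<noteq> {}" by auto
  obtain V :: "nat \<Rightarrow> 'v set" and E \<phi> h where "tree_model \<Gamma> X \<Phi> d V E \<phi> h"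
    using d_regular_imp_tree_model[OF assms(3) act] by blast
  then interpret tree_model \<Gamma> X \<Phi> d V E \<phi> h .
  have types: "\<exists>S \<subseteq> ?P. \<tau> = steinitz_type (infinite_power S)" if "\<tau> \<in> typeset \<Gamma> X \<Phi>" for \<tau>
    by (rule typeset_model[OF minimal ne that])
  \<comment> \<open>A type is determined by its set of infinite primes, so the subsets of
    \<open>?P\<close> bound the number of types.\<close>
  have sub: "typeset \<Gamma> X \<Phi> \<subseteq> (\<lambda>S. steinitz_type (infinite_power S)) ` Pow ?P"
  proof
    fix \<tau> assume "\<tau> \<in> typeset \<Gamma> X \<Phi>"
    then obtain S where "S \<in> Pow ?P" "\<tau> = steinitz_type (infinite_power S)"
      using types by blast
    then show "\<tau> \<in> (\<lambda>S. steinitz_type (infinite_power S)) ` Pow ?P" by (rule rev_image_eqI)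
  qed
  have fin: "finite (Pow ?P)" using finite_prime_divisors_upto by simp
  have "card (typeset \<Gamma> X \<Phi>) \<le> card (Pow ?P)"
    by (rule surj_card_le[OF fin sub])
  also have "\<dots> = 2 ^ N"
    using finite_prime_divisors_upto assms(4) by (simp add: card_Pow)
  also have "\<dots> = (\<Sum>k = 0..N. N choose k)"
    by (simp add: choose_row_sum atLeast0AtMost)
  finally have card: "card (typeset \<Gamma> X \<Phi>) \<le> (\<Sum>k = 0..N. N choose k)" .
  have "real (\<Sum>k = 0..N. N choose k) = (\<Sum>k = 0..N. fact N / (fact (N - k) * fact k))"
    unfolding of_nat_sum
    by (intro sum.cong refl) (simp add: binomial_fact mult.commute)
  moreover have "finite (typeset \<Gamma> X \<Phi>)"
    using sub fin by (meson finite_imageI finite_subset)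
  moreover have "\<forall>\<tau> \<in> typeset \<Gamma> X \<Phi>. \<exists>\<xi>. \<tau> = steinitz_type \<xi> \<and> finite_prime_spectrum \<xi> = {} \<and>
      prime_spectrum \<xi> = infinite_prime_spectrum \<xi>"
  proof
    fix \<tau> assume "\<tau> \<in> typeset \<Gamma> X \<Phi>"
    then obtain S where "\<tau> = steinitz_type (infinite_power S)" using types by blast
    then show "\<exists>\<xi>. \<tau> = steinitz_type \<xi> \<and> finite_prime_spectrum \<xi> = {} \<and>
        prime_spectrum \<xi> = infinite_prime_spectrum \<xi>"
      using prime_spectra_infinite_power by (intro exI[of _ "infinite_power S"] conjI)
  qed
  ultimately show ?thesis using card by blast
qed

end
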